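(* Let $n \ge 2$ and $A \in \mathbb{R}^{n \times n}$. Then $A$ is an almost $P$-matrix of the second category if and only if the following three conditions hold: (a) $N(A) \cap \mathrm{int}(\mathbb{R}_+^n) = \emptyset$; (b) for every $x \in \mathbb{R}^n$ with $x_i (Ax)_i \le 0$ for all $i \in \{1,\dots,n\}$: if $x_k = 0$ for some $k$, then $x = 0$; otherwise $x > 0$ or $x < 0$; (c) $A(\mathrm{int}(\mathbb{R}_+^n)) \cap \mathrm{int}(\mathbb{R}_-^n) \neq \emptyset$.
   Context: A matrix $A \in \mathbb{R}^{n\times n}$ with $n \ge 2$ is an almost $P$-matrix if all its proper principal minors are positive and $\det A < 0$ (in particular $A$ is invertible). A real $n \times n$ matrix is an $N$-matrix if all its principal minors (including the determinant) are negative; an $N$-matrix is of the first category if it has at least one positive entry, and otherwise it is of the second category. An almost $P$-matrix $A$ is of the second category if $A^{-1}$ is an $N$-matrix of the second category. $N(A)$ denotes the null space of $A$; $\mathbb{R}_+^n$ and $\mathbb{R}_-^n$ are the sets of vectors with all entries $\ge 0$, respectively all entries $\le 0$, and $\mathrm{int}$ denotes the interior in $\mathbb{R}^n$ with the Euclidean topology. For vectors, $x>0$ ($x<0$) means all entries are positive (negative). $A(S) = \{Ax : x \in S\}$. *)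

theory Defs
  imports "HOL-Analysis.Analysis"
begin

(* The Leibniz formula of the library's det, restricted to the rows and columns with index in S.
   For S = {} this is 1, so predicates on minors exclude the empty index set. *)
definition principal_minor :: "'a::comm_ring_1^'n^'n \<Rightarrow> 'n set \<Rightarrow> 'a" where
  "principal_minor A S = (\<Sum>p | p permutes S. of_int (sign p) * (\<Prod>i\<in>S. A $ i $ p i))"

lemma principal_minor_UNIV: "principal_minor A UNIV = det A"
  by (simp add: principal_minor_def det_def)

lemma principal_minor_eq_det_submatrix:
  fixes A :: "'a::comm_ring_1^'n^'n" and f :: "'m::finite \<Rightarrow> 'n"
  assumes f: "bij_betw f UNIV S"
  shows "principal_minor A S = det (\<chi> i j. A $ f i $ f j)"
proof -
  have inj: "inj_on f UNIV" and S: "S = f ` UNIV"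
    using f by (auto simp: bij_betw_def)
  have bij: "bij_betw (map_permutation UNIV f) {p. p permutes UNIV} {p. p permutes S}"
  proof (rule bij_betwI[where g = "map_permutation S (inv_into UNIV f)"])
    have f': "bij_betw (inv_into UNIV f) S UNIV"
      using f by (rule bij_betw_inv_into)
    show "map_permutation UNIV f \<in> {p. p permutes UNIV} \<rightarrow> {p. p permutes S}"
      using map_permutation_permutes[OF f] by auto
    show "map_permutation S (inv_into UNIV f) \<in> {p. p permutes S} \<rightarrow> {p. p permutes UNIV}"
      using map_permutation_permutes[OF f'] by auto
    show "map_permutation S (inv_into UNIV f) (map_permutation UNIV f p) = p"
      if "p \<in> {p. p permutes UNIV}" for p
      using that by (intro map_permutation_compose_inv[OF f]) (auto simp: inj)
    show "map_permutation UNIV f (map_permutation S (inv_into UNIV f) p) = p"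
      if "p \<in> {p. p permutes S}" for p
      using that by (intro map_permutation_compose_inv[OF f']) (auto simp: S f_inv_into_f)
  qed
  show ?thesis
    unfolding principal_minor_def det_def
    by (rule sum.reindex_bij_betw[OF bij, symmetric, THEN trans])
       (auto simp: S prod.reindex[OF inj] map_permutation_apply[OF inj] 
             sign_map_permutation[OF inj] intro!: sum.cong)
qed

definition almost_P_matrix :: "real^'n::finite^'n \<Rightarrow> bool" where
  "almost_P_matrix A \<longleftrightarrow>
     CARD('n) \<ge> 2 \<and> (\<forall>S. S \<noteq> {} \<and> S \<noteq> UNIV \<longrightarrow> principal_minor A S > 0) \<and> det A < 0"

definition N_matrix :: "real^'n^'n \<Rightarrow> bool" where
  "N_matrix A \<longleftrightarrow> (\<forall>S. S \<noteq> {} \<longrightarrow> principal_minor A S < 0)"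

definition N_matrix_first_category :: "real^'n^'n \<Rightarrow> bool" where
  "N_matrix_first_category A \<longleftrightarrow> N_matrix A \<and> (\<exists>i j. A $ i $ j > 0)"

definition N_matrix_second_category :: "real^'n^'n \<Rightarrow> bool" where
  "N_matrix_second_category A \<longleftrightarrow> N_matrix A \<and> \<not> N_matrix_first_category A"

definition almost_P_matrix_second_category :: "real^'n^'n \<Rightarrow> bool" where
  "almost_P_matrix_second_category A \<longleftrightarrow>
     almost_P_matrix A \<and> N_matrix_second_category (matrix_inv A)"

definition null_space :: "real^'n^'m \<Rightarrow> (real^'n) set" where
  "null_space A = {x. A *v x = 0}"

definition nonneg_orthant :: "(real^'n) set" where
  "nonneg_orthant = {x. \<forall>i. x $ i \<ge> 0}"

definition nonpos_orthant :: "(real^'n) set" where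
  "nonpos_orthant = {x. \<forall>i. x $ i \<le> 0}"

(* Not the library's order on vectors, where 0 < x only means 0 \<le> x and x \<noteq> 0. *)
definition vec_pos :: "real^'n \<Rightarrow> bool" where
  "vec_pos x \<longleftrightarrow> (\<forall>i. x $ i > 0)"

definition vec_neg :: "real^'n \<Rightarrow> bool" where
  "vec_neg x \<longleftrightarrow> (\<forall>i. x $ i < 0)"

end

theory Submission
  imports Defs
begin

text \<open>
  By the Fiedler--Ptak argument, positivity of the principal minors with index set inside the
  support of a vector is what prevents a matrix from reversing the sign of that vector. Hence
  condition (b) for vectors with a zero entry amounts to positivity of the proper principal minors,
  (c) then forces the determinant to be nonpositive, and (a) with (b) makes it nonzero. For the categories, let \<open>B\<close> be the inverse
  of \<open>A\<close>. If (b) holds and \<open>B\<close> has negative diagonal, then (b) applied to a column of \<open>B\<close>, whose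
  image under \<open>A\<close> is a unit vector, shows that the column is negative. Conversely, if \<open>B\<close> is
  negative and \<open>A\<close> reverses the sign of a vector with entries of both signs, subtracting a multiple
  of a column of \<open>B\<close> produces a nonzero sign-reversed vector with a zero entry.
\<close>

section \<open>Principal minors as determinants of full size\<close>

text \<open>Unit rows outside \<open>S\<close> keep the index type fixed, so row linearity,
  multiplicativity and the kernel criterion for \<open>det\<close> all apply to minors.\<close>

definition bordered_submatrix :: "'a::comm_ring_1^'n^'n \<Rightarrow> 'n set \<Rightarrow> 'a^'n^'n" where
  "bordered_submatrix A S = (\<chi> i. if i \<in> S then A $ i else axis i 1)"

text \<open>A permutation moving an index outside \<open>S\<close> meets a zero of a unit row; the
  remaining ones only gain factors 1.\<close>

lemma principal_minor_eq_det: "principal_minor A S = det (bordered_submatrix A S)"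
proof -
  have zero: "(\<Prod>i\<in>UNIV. bordered_submatrix A S $ i $ p i) = 0"
    if p: "p permutes UNIV" "\<not> p permutes S" for p
  proof -
    obtain i where "i \<notin> S" "p i \<noteq> i"
      using p by (auto simp: permutes_def)
    then have "bordered_submatrix A S $ i $ p i = 0"
      by (simp add: bordered_submatrix_def axis_def)
    then show ?thesis
      by (meson UNIV_I finite_class.finite_UNIV prod_zero)
  qed
  have eq: "(\<Prod>i\<in>UNIV. bordered_submatrix A S $ i $ p i) = (\<Prod>i\<in>S. A $ i $ p i)"
    if p: "p permutes S" for p
    by (rule prod.mono_neutral_cong_right)
       (use p in \<open>auto simp: bordered_submatrix_def axis_def permutes_def\<close>)
  have "(\<Sum>p | p permutes S. of_int (sign p) * (\<Prod>i\<in>S. A $ i $ p i)) =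
        (\<Sum>p | p permutes UNIV. of_int (sign p) * (\<Prod>i\<in>UNIV. bordered_submatrix A S $ i $ p i))"
    by (rule sum.mono_neutral_cong_left)
       (auto simp: eq zero finite_permutations intro: permutes_subset)
  then show ?thesis
    by (simp add: principal_minor_def det_def)
qed

lemma bordered_submatrix_mult_vec:
  "(bordered_submatrix A S *v x) $ i = (if i \<in> S then (A *v x) $ i else x $ i)"
  by (simp add: bordered_submatrix_def matrix_vector_mult_def axis_def
        if_distrib[where f = "\<lambda>c. c * _"] cong: if_cong)

lemma principal_minor_empty: "principal_minor A {} = 1"
  by (simp add: principal_minor_def)

text \<open>Jacobi's identity for complementary minors: multiplying by \<open>A\<close> turns the
  rows of \<open>B\<close> into unit rows and the unit rows into rows of \<open>A\<close>.\<close>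

lemma principal_minor_inverse:
  fixes A B :: "'a::comm_ring_1^'n^'n"
  assumes "B ** A = mat 1"
  shows "principal_minor B S * det A = principal_minor A (- S)"
proof -
  have BA: "(\<Sum>k\<in>UNIV. B $ i $ k * A $ k $ j) = (if i = j then 1 else 0)" for i j
    using arg_cong[OF assms, of "\<lambda>M. M $ i $ j"] by (simp add: matrix_matrix_mult_def mat_def)
  have "bordered_submatrix B S ** A = bordered_submatrix A (- S)"
    by (auto simp: vec_eq_iff matrix_matrix_mult_def bordered_submatrix_def axis_def BA
        if_distrib[where f = "\<lambda>c. c * _"] cong: if_cong)
  then show ?thesis
    by (metis det_mul principal_minor_eq_det)
qed

text \<open>Linearity in row \<open>k\<close>: the added unit row deletes \<open>k\<close> from the
  index set.\<close>

lemma principal_minor_add_diagonal_entry: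
  fixes A A' :: "'a::comm_ring_1^'n^'n"
  assumes A': "\<And>i. A' $ i = (if i = k then A $ k + c *s axis k 1 else A $ i)"
  shows "principal_minor A' S =
    principal_minor A S + (if k \<in> S then c * principal_minor A (S - {k}) else 0)"
proof (cases "k \<in> S")
  case True
  let ?M = "bordered_submatrix A S"
  have "bordered_submatrix A' S = (\<chi> i. if i = k then A $ k + c *s axis k 1 else ?M $ i)"
    using True by (auto simp: bordered_submatrix_def vec_eq_iff A')
  moreover have "(\<chi> i. if i = k then A $ k else ?M $ i) = ?M"
    using True by (auto simp: bordered_submatrix_def vec_eq_iff)
  moreover have "(\<chi> i. if i = k then axis k 1 else ?M $ i) = bordered_submatrix A (S - {k})"
    by (auto simp: bordered_submatrix_def vec_eq_iff)
  ultimately show ?thesis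
    using True by (simp add: principal_minor_eq_det det_row_add det_row_mul)
next
  case False
  then have "bordered_submatrix A' S = bordered_submatrix A S"
    by (auto simp: bordered_submatrix_def vec_eq_iff A')
  with False show ?thesis
    by (simp add: principal_minor_eq_det)
qed

text \<open>Rows are changed one at a time. Each change adds a nonnegative multiple of a smaller
  minor, so the induction must carry all \<open>T \<subseteq> S\<close> at once.\<close>

lemma principal_minor_add_diagonal_pos:
  fixes A :: "'a::linordered_idom^'n^'n"
  assumes pos: "\<And>T. T \<subseteq> S \<Longrightarrow> principal_minor A T > 0"
    and d: "\<And>i. d i \<ge> 0" and "T \<subseteq> S"
  shows "principal_minor (\<chi> i. A $ i + d i *s axis i 1) T > 0"
proof -
  have "\<forall>T\<subseteq>S. principal_minor (\<chi> i. if i \<in> F then A $ i + d i *s axis i 1 else A $ i) T > 0"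
    if "finite F" for F
    using that
  proof induction
    case empty
    then show ?case by (simp add: pos)
  next
    case (insert k F)
    let ?A = "\<lambda>F. \<chi> i. if i \<in> F then A $ i + d i *s axis i 1 else A $ i"
    show ?case
    proof (intro allI impI)
      fix T assume T: "T \<subseteq> S"
      have "principal_minor (?A (insert k F)) T =
        principal_minor (?A F) T + (if k \<in> T then d k * principal_minor (?A F) (T - {k}) else 0)"
        by (rule principal_minor_add_diagonal_entry) (use insert.hyps in auto)
      moreover have "principal_minor (?A F) T > 0" "principal_minor (?A F) (T - {k}) > 0"
        using insert.IH T by blast+
      ultimately show "principal_minor (?A (insert k F)) T > 0"
        using d[of k] by (simp add: add_pos_nonneg)
    qed
  qed
  from this[of UNIV] show ?thesis
    using \<open>T \<subseteq> S\<close> by simp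
qed

section \<open>Sign reversal and positivity of principal minors\<close>

lemma det_eq_0_iff_kernel:
  fixes A :: "'a::field^'n^'n"
  shows "det A = 0 \<longleftrightarrow> (\<exists>x. x \<noteq> 0 \<and> A *v x = 0)"
  by (metis invertible_det_nz invertible_left_inverse matrix_left_invertible_ker)

text \<open>A nonnegative diagonal can be added to \<open>A\<close> so that the image of
  \<open>x\<close> vanishes on the support of \<open>x\<close>, while the minor there stays
  positive.\<close>

lemma sign_reversed_imp_zero:
  fixes A :: "real^'n^'n"
  assumes pos: "\<And>T. T \<subseteq> {i. x $ i \<noteq> 0} \<Longrightarrow> principal_minor A T > 0"
    and rev: "\<And>i. x $ i * (A *v x) $ i \<le> 0"
  shows "x = 0"
proof -
  define S where "S = {i. x $ i \<noteq> 0}"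
  \<comment> \<open>Off the support of \<open>x\<close>, division by zero gives \<open>d i = 0\<close>.\<close>
  define d where "d i = - (A *v x) $ i / x $ i" for i
  define A' where "A' = (\<chi> i. A $ i + d i *s axis i 1)"
  have d: "d i \<ge> 0" for i
    using rev[of i] by (auto simp: d_def mult_le_0_iff divide_nonneg_neg divide_le_0_iff)
  have "principal_minor A' S > 0"
    unfolding A'_def by (rule principal_minor_add_diagonal_pos) (use pos d S_def in auto)
  then have det: "det (bordered_submatrix A' S) \<noteq> 0"
    by (simp add: principal_minor_eq_det)
  have "(A' *v x) $ i = (A *v x) $ i + d i * x $ i" for i
    by (simp add: A'_def matrix_vector_mult_def axis_def algebra_simps sum.distrib
        if_distrib[where f = "\<lambda>c. _ * c"] cong: if_cong)
  then have "bordered_submatrix A' S *v x = 0"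
    by (auto simp: vec_eq_iff bordered_submatrix_mult_vec S_def d_def)
  with det show ?thesis
    using det_eq_0_iff_kernel by blast
qed

text \<open>
  The principal minors of the segment from \<open>A\<close> to the identity do not vanish, and at the end of
  the segment they are 1.
\<close>
lemma principal_minor_pos_if_no_sign_reversed:
  fixes A :: "real^'n^'n"
  assumes no_rev: "\<And>x. (\<And>i. i \<notin> S \<Longrightarrow> x $ i = 0) \<Longrightarrow> (\<And>i. x $ i * (A *v x) $ i \<le> 0) \<Longrightarrow> x = 0"
  shows "principal_minor A S > 0"
proof (rule ccontr)
  define C where "C t = (\<chi> i. (1 - t) *s A $ i + t *s axis i 1)" for t :: real
  define f where "f t = principal_minor (C t) S" for t
  assume "\<not> principal_minor A S > 0"
  then have f0: "f 0 \<le> 0"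
    by (simp add: f_def C_def)
  have "C 1 = mat 1"
    by (simp add: C_def vec_eq_iff mat_def axis_def)
  then have "bordered_submatrix (C 1) S = mat 1"
    by (simp add: bordered_submatrix_def vec_eq_iff mat_def axis_def)
  then have f1: "f 1 = 1"
    by (simp add: f_def principal_minor_eq_det)
  have "continuous_on {0..1} f"
    unfolding f_def principal_minor_def C_def by (auto intro!: continuous_intros)
  then obtain t where t: "0 \<le> t" "t \<le> 1" "f t = 0"
    using IVT'[of f 0 0 1] f0 f1 by auto
  then have t1: "t < 1"
    using f1 by (cases "t = 1") auto
  obtain x where x: "x \<noteq> 0" "bordered_submatrix (C t) S *v x = 0"
    using t(3) det_eq_0_iff_kernel unfolding f_def principal_minor_eq_det by blast
  have Cx: "(C t *v x) $ i = (1 - t) * (A *v x) $ i + t * x $ i" for i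
    by (simp add: C_def matrix_vector_mult_def axis_def algebra_simps sum.distrib sum_distrib_left
        sum_subtractf if_distrib[where f = "\<lambda>c. _ * c"] cong: if_cong)
  have supp: "x $ i = 0" if "i \<notin> S" for i
    using arg_cong[OF x(2), of "\<lambda>v. v $ i"] that by (simp add: bordered_submatrix_mult_vec)
  \<comment> \<open>On \<open>S\<close> the kernel equation makes \<open>A *v x\<close> equal to
    \<open>x\<close> times \<open>- t / (1 - t)\<close>, which is a nonpositive factor.\<close>
  have "x $ i * (A *v x) $ i \<le> 0" for i
  proof (cases "i \<in> S")
    case True
    then have eq: "(1 - t) * (A *v x) $ i = - t * x $ i"
      using arg_cong[OF x(2), of "\<lambda>v. v $ i"] Cx[of i] by (simp add: bordered_submatrix_mult_vec)
    have "(1 - t) * (x $ i * (A *v x) $ i) = x $ i * ((1 - t) * (A *v x) $ i)"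
      by (simp add: algebra_simps)
    also have "\<dots> = - (t * (x $ i)\<^sup>2)"
      unfolding eq by (simp add: power2_eq_square)
    also have "\<dots> \<le> 0"
      using t(1) by simp
    finally show ?thesis
      using t1 by (simp add: mult_le_0_iff)
  next
    case False
    then show ?thesis by (simp add: supp)
  qed
  with supp no_rev x(1) show False by blast
qed

section \<open>Orthants, inverses and negative matrices\<close>

lemma interior_INT_finite:
  "finite I \<Longrightarrow> interior (\<Inter>i\<in>I. S i) = (\<Inter>i\<in>I. interior (S i))"
  by (induction rule: finite_induct) simp_all

lemma interior_nonneg_orthant: "interior nonneg_orthant = {x :: real^'n. vec_pos x}"
proof -
  have "nonneg_orthant = (\<Inter>i. {x :: real^'n. x $ i \<ge> 0})"
    by (auto simp: nonneg_orthant_def)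
  then have "interior nonneg_orthant = (\<Inter>i. interior {x :: real^'n. x $ i \<ge> 0})"
    by (metis interior_INT_finite finite)
  then show ?thesis
    by (auto simp: vec_pos_def)
qed

lemma interior_nonpos_orthant: "interior nonpos_orthant = {x :: real^'n. vec_neg x}"
proof -
  have "nonpos_orthant = (\<Inter>i. {x :: real^'n. x $ i \<le> 0})"
    by (auto simp: nonpos_orthant_def)
  then have "interior nonpos_orthant = (\<Inter>i. interior {x :: real^'n. x $ i \<le> 0})"
    by (metis interior_INT_finite finite)
  then show ?thesis
    by (auto simp: vec_neg_def)
qed

lemma invertible_matrix_inv:
  assumes "invertible A"
  shows "A ** matrix_inv A = mat 1" "matrix_inv A ** A = mat 1"
  using someI_ex[OF assms[unfolded invertible_def]] by (simp_all add: matrix_inv_def)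

lemma mult_axis_column: "((M :: 'a::semiring_1^'n^'m) *v axis j 1) $ i = M $ i $ j"
  by (simp add: matrix_vector_mult_def axis_def if_distrib[where f = "\<lambda>c. _ * c"] cong: if_cong)

text \<open>The absence of positive entries leaves zeros possible. The diagonal is negative as
  1-by-1 minors, and a zero at \<open>(i, j)\<close> off the diagonal would make the minor on
  \<open>{i, j}\<close> a product of two negative diagonal entries.\<close>

lemma N_matrix_second_category_iff:
  "N_matrix_second_category B \<longleftrightarrow> N_matrix B \<and> (\<forall>i j. B $ i $ j < 0)"
proof -
  have "B $ i $ j < 0" if N: "N_matrix B" and le: "\<forall>i j. B $ i $ j \<le> 0" for i j
  proof (cases "i = j")
    case True
    have "principal_minor B {i} < 0"
      using N by (simp add: N_matrix_def)
    with True show ?thesis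
      by (simp add: principal_minor_def)
  next
    case False
    have diag: "B $ k $ k < 0" for k
      using N[unfolded N_matrix_def, rule_format, of "{k}"] by (simp add: principal_minor_def)
    have perms: "{p. p permutes {i, j}} = {id, Transposition.transpose i j}"
      using False by (auto simp: permutes_doubleton_iff)
    have "principal_minor B {i, j} < 0"
      using N by (simp add: N_matrix_def)
    moreover have "id \<noteq> Transposition.transpose i j"
      using False by (metis id_apply transpose_apply_first)
    ultimately have "B $ i $ i * B $ j $ j - B $ i $ j * B $ j $ i < 0"
      using False by (simp add: principal_minor_def perms sign_swap_id)
    moreover have "B $ i $ i * B $ j $ j > 0"
      using diag by (simp add: mult_neg_neg)
    ultimately have "B $ i $ j \<noteq> 0" by auto
    with le show ?thesis by (simp add: order_less_le)
  qed
  then show ?thesis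
    unfolding N_matrix_second_category_def N_matrix_first_category_def
    by (meson not_le less_imp_le)
qed

text \<open>A zero entry makes the support proper, so \<open>sign_reversed_imp_zero\<close> applies;
  mixed signs are reduced to that case.\<close>

lemma almost_P_matrix_sign_reversed:
  fixes A B :: "real^'n^'n"
  assumes pos: "\<And>S. S \<noteq> UNIV \<Longrightarrow> principal_minor A S > 0"
    and AB: "A ** B = mat 1" and B: "\<And>i j. B $ i $ j < 0"
    and rev: "\<And>i. x $ i * (A *v x) $ i \<le> 0"
  shows "if \<exists>k. x $ k = 0 then x = 0 else vec_pos x \<or> vec_neg x"
proof -
  have zero: "w = 0" if "w $ k = 0" "\<And>i. w $ i * (A *v w) $ i \<le> 0" for w k
  proof (rule sign_reversed_imp_zero)
    fix T assume "T \<subseteq> {i. w $ i \<noteq> 0}"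
    then show "principal_minor A T > 0"
      using that(1) by (intro pos) auto
  qed (fact that(2))
  show ?thesis
  proof (cases "\<exists>k. x $ k = 0")
    case True
    then show ?thesis using zero[OF _ rev] by auto
  next
    case nz: False
    have "vec_pos x \<or> vec_neg x"
    proof (rule ccontr)
      assume mixed: "\<not> (vec_pos x \<or> vec_neg x)"
      then obtain j where j: "x $ j > 0"
        using nz unfolding vec_neg_def by (meson linorder_neqE)
      define N where "N = {i. x $ i < 0}"
      have "N \<noteq> {}"
        using mixed nz unfolding vec_pos_def N_def by (metis (mono_tags) linorder_neqE empty_Collect_eq)
      \<comment> \<open>Adding a positive multiple of \<open>z\<close> to \<open>x\<close> changes
        \<open>A *v x\<close> only at \<open>j\<close>, and lowers it there, as
        \<open>x $ j > 0\<close> permits.\<close>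
      define z where "z = - (B *v axis j 1)"
      have z: "z $ i > 0" for i
        using B by (simp add: z_def mult_axis_column)
      have Az: "A *v z = - axis j 1"
        unfolding z_def using AB
        by (simp add: linear_neg[OF matrix_vector_mul_linear] matrix_vector_mul_assoc)
      \<comment> \<open>Ratio test: \<open>t\<close> is the first time a negative entry of
        \<open>x + t *s z\<close> reaches zero, so no negative entry has become positive.\<close>
      define t where "t = Min ((\<lambda>i. - x $ i / z $ i) ` N)"
      have "t \<in> (\<lambda>i. - x $ i / z $ i) ` N"
        unfolding t_def using \<open>N \<noteq> {}\<close> by (intro Min_in) auto
      then obtain k where k: "k \<in> N" "t = - x $ k / z $ k" by auto
      have t_le: "t \<le> - x $ i / z $ i" if "i \<in> N" for i
        unfolding t_def using that by (intro Min_le) auto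
      have "t > 0"
        using k z[of k] by (simp add: N_def divide_neg_pos)
      define w where "w = x + t *s z"
      have Aw: "(A *v w) $ i = (A *v x) $ i - (if i = j then t else 0)" for i
        unfolding w_def by (simp add: matrix_vector_right_distrib vector_scalar_commute Az axis_def)
      have "w $ k = 0"
        using k z[of k] by (simp add: w_def)
      moreover have "w $ i * (A *v w) $ i \<le> 0" for i
      proof (cases "i \<in> N")
        case True
        then have "i \<noteq> j" "(A *v x) $ i \<ge> 0"
          using j rev[of i] by (auto simp: N_def mult_le_0_iff)
        moreover have "w $ i \<le> 0"
          using t_le[OF True] z[of i] by (simp add: w_def field_simps)
        ultimately show ?thesis by (simp add: Aw mult_nonpos_nonneg)
      next
        case False
        then have xi: "x $ i > 0"
          using nz by (metis N_def linorder_neqE mem_Collect_eq)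
        then have "(A *v x) $ i \<le> 0"
          using rev[of i] by (simp add: mult_le_0_iff)
        then have "(A *v w) $ i \<le> 0"
          using \<open>t > 0\<close> by (auto simp: Aw)
        moreover have "w $ i \<ge> 0"
          using xi z[of i] \<open>t > 0\<close> by (simp add: w_def)
        ultimately show ?thesis by (simp add: mult_nonneg_nonpos)
      qed
      ultimately have "w = 0" by (rule zero)
      moreover have "w $ j > 0"
        using j z[of j] \<open>t > 0\<close> by (simp add: w_def add_pos_pos)
      ultimately show False by simp
    qed
    with nz show ?thesis by simp
  qed
qed

theorem theorem4p2:
  fixes A :: "real^'n^'n"
  assumes "CARD('n) \<ge> 2"
  shows "almost_P_matrix_second_category A \<longleftrightarrow>
      null_space A \<inter> interior nonneg_orthant = {} \<and>
      (\<forall>x. (\<forall>i. x $ i * (A *v x) $ i \<le> 0) \<longrightarrow>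
         (if \<exists>k. x $ k = 0 then x = 0 else vec_pos x \<or> vec_neg x)) \<and>
      ((*v) A) ` interior nonneg_orthant \<inter> interior nonpos_orthant \<noteq> {}"
    (is "?L \<longleftrightarrow> ?a \<and> ?b \<and> ?c")
proof
  assume L: ?L
  define B where "B = matrix_inv A"
  have det: "det A < 0"
    using L by (simp add: almost_P_matrix_second_category_def almost_P_matrix_def)
  \<comment> \<open>The empty index set, which the definition excludes, has minor 1.\<close>
  have pos: "principal_minor A S > 0" if "S \<noteq> UNIV" for S
    using L that principal_minor_empty[of A]
    by (cases "S = {}") (simp_all add: almost_P_matrix_second_category_def almost_P_matrix_def)
  have B: "B $ i $ j < 0" for i j
    using L by (simp add: almost_P_matrix_second_category_def N_matrix_second_category_iff B_def)
  have inv: "invertible A"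
    using det by (simp add: invertible_det_nz)
  then have AB: "A ** B = mat 1" and BA: "B ** A = mat 1"
    unfolding B_def by (simp_all add: invertible_matrix_inv)
  have "\<not> vec_pos (0 :: real^'n)"
    by (simp add: vec_pos_def)
  moreover have "x = 0" if "A *v x = 0" for x
    using that BA by (metis matrix_vector_mul_assoc matrix_vector_mul_lid matrix_vector_mult_0_right)
  ultimately have a: ?a
    by (auto simp: null_space_def interior_nonneg_orthant)
  have b: ?b
    using almost_P_matrix_sign_reversed[OF pos AB B] by blast
  \<comment> \<open>The preimage of the vector with all entries -1; its entries are negated row sums
    of \<open>B\<close>.\<close>
  define z where "z = B *v (- 1)"
  have "A *v z = - 1"
    unfolding z_def using AB by (simp add: matrix_vector_mul_assoc)
  moreover have "vec_pos z"
    unfolding vec_pos_def z_def matrix_vector_mult_def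
    using B by (auto intro!: sum_pos simp del: mult_minus_right sum_negf)
  ultimately have c: ?c
    by (force simp: interior_nonneg_orthant interior_nonpos_orthant vec_neg_def)
  from a b c show "?a \<and> ?b \<and> ?c" by simp
next
  assume R: "?a \<and> ?b \<and> ?c"
  then have a: "\<And>x. A *v x = 0 \<Longrightarrow> \<not> vec_pos x" and b: ?b
    by (auto simp: null_space_def interior_nonneg_orthant)
  obtain z where z: "vec_pos z" "vec_neg (A *v z)"
    using R by (auto simp: interior_nonneg_orthant interior_nonpos_orthant)
  \<comment> \<open>A vector supported in a proper subset has a zero entry, so (b) forbids reversing
    its sign unless it is zero.\<close>
  have pos: "principal_minor A S > 0" if S: "S \<noteq> UNIV" for S
    by (rule principal_minor_pos_if_no_sign_reversed) (use b S in \<open>metis UNIV_eq_I\<close>)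
  \<comment> \<open>By (b) a nonzero kernel vector has a strict sign; it or its negative then
    contradicts (a).\<close>
  have "x = 0" if x: "A *v x = 0" for x
  proof (rule ccontr)
    assume "x \<noteq> 0"
    then have "vec_pos x \<or> vec_neg x"
      using b x by (metis mult_zero_right order_refl zero_index)
    then have "vec_pos x \<or> vec_pos (- x)"
      by (auto simp: vec_pos_def vec_neg_def)
    moreover have "A *v (- x) = 0"
      using x by (simp add: linear_neg[OF matrix_vector_mul_linear])
    ultimately show False using a x by blast
  qed
  then have det_nz: "det A \<noteq> 0"
    using det_eq_0_iff_kernel by blast
  \<comment> \<open>Otherwise all principal minors are positive, yet \<open>A\<close> reverses the
    sign of the positive vector \<open>z\<close> from (c).\<close>
  have det: "det A < 0"
  proof (rule ccontr)
    assume "\<not> det A < 0"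
    then have "principal_minor A S > 0" for S
      using det_nz pos[of S] by (cases "S = UNIV") (auto simp: principal_minor_UNIV)
    moreover have "z $ i * (A *v z) $ i \<le> 0" for i
      using z by (simp add: vec_pos_def vec_neg_def mult_nonneg_nonpos less_imp_le)
    ultimately have "z = 0"
      using sign_reversed_imp_zero by blast
    with z show False by (simp add: vec_pos_def)
  qed
  define B where "B = matrix_inv A"
  have "invertible A"
    using det by (simp add: invertible_det_nz)
  then have AB: "A ** B = mat 1" and BA: "B ** A = mat 1"
    unfolding B_def by (simp_all add: invertible_matrix_inv)
  \<comment> \<open>The complement of \<open>S\<close> is proper, so its minor in \<open>A\<close>
    is positive; for \<open>S = UNIV\<close> it is the empty minor.\<close>
  have N: "principal_minor B S < 0" if "S \<noteq> {}" for S
  proof -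
    have "principal_minor B S * det A > 0"
      unfolding principal_minor_inverse[OF BA] using that by (intro pos) auto
    with det show ?thesis by (simp add: zero_less_mult_iff)
  qed
  have "B $ i $ j < 0" for i j
  proof -
    define u where "u = B *v axis j 1"
    have Au: "A *v u = axis j 1"
      unfolding u_def using AB by (simp add: matrix_vector_mul_assoc)
    have uj: "u $ j < 0"
      using N[of "{j}"] by (simp add: u_def mult_axis_column principal_minor_def)
    \<comment> \<open>The product is nonzero only at \<open>k = j\<close>, where it equals the
      negative diagonal entry of \<open>B\<close>; this entry also decides the sign left open by
      (b).\<close>
    have "u $ k * (A *v u) $ k \<le> 0" for k
      using uj by (simp add: Au axis_def)
    then have "vec_neg u"
      using b uj by (metis vec_pos_def less_asym zero_index)
    then show ?thesis
      by (simp add: vec_neg_def u_def mult_axis_column)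
  qed
  then show ?L
    using N pos det assms
    by (simp add: almost_P_matrix_second_category_def almost_P_matrix_def
        N_matrix_second_category_iff N_matrix_def B_def)
qed

end
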